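(* For every integer $n\ge 1$, $$\gamma_{rdR}(P_2\times P_n)=\begin{cases}2n+4, & n\ge 4,\\ 2n+2, & n\le 3.\end{cases}$$
   Context: Graphs are finite and simple. A restrained double Roman dominating function (RDRD-function) of a graph $G$ is a function $f:V(G)\to\{0,1,2,3\}$ such that: (i) if $f(v)=0$, then $v$ has at least two neighbours assigned 2 under $f$ or at least one neighbour assigned 3; (ii) if $f(v)=1$, then $v$ has a neighbour $u$ with $f(u)\ge 2$; (iii) the subgraph of $G$ induced by the vertices assigned 0 contains no isolated vertex. The weight of $f$ is $\sum_{v\in V(G)}f(v)$, and $\gamma_{rdR}(G)$ is the minimum weight of an RDRD-function of $G$. $P_n$ is the path on $n$ vertices. The cardinal (direct) product $G\times H$ has vertex set $V(G)\times V(H)$, with $(u,v)(u',v')$ an edge iff $uu'\in E(G)$ and $vv'\in E(H)$. *)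

theory Defs
  imports "Graph_Theory.Graph_Theory"
begin

text \<open>
  Finite simple graphs are rendered by the locale \<^locale>\<open>pair_graph\<close>: finite, symmetric, loop-free
  digraphs without parallel arcs, so that an edge \<open>uv\<close> is the pair of arcs \<open>(u, v)\<close>, \<open>(v, u)\<close>.
  The definitions below are meant for such graphs only.
\<close>

definition path_graph :: "nat \<Rightarrow> nat pair_pre_digraph" where
  "path_graph n = \<lparr> pverts = {1..n},
     parcs = {(i, j). i \<in> {1..n} \<and> j \<in> {1..n} \<and> (j = i + 1 \<or> i = j + 1)} \<rparr>"

definition direct_product ::
    "'a pair_pre_digraph \<Rightarrow> 'b pair_pre_digraph \<Rightarrow> ('a \<times> 'b) pair_pre_digraph" where
  "direct_product G H = \<lparr> pverts = pverts G \<times> pverts H,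
     parcs = {((u, v), (u', v')). (u, u') \<in> parcs G \<and> (v, v') \<in> parcs H} \<rparr>"

definition isolated_vertex :: "('a, 'b) pre_digraph \<Rightarrow> 'a \<Rightarrow> bool" where
  "isolated_vertex G v \<longleftrightarrow> v \<in> verts G \<and> \<not> (\<exists>u. v \<rightarrow>\<^bsub>G\<^esub> u)"

text \<open>Only the values of \<open>f\<close> on the vertex set matter.\<close>

definition rdrd_function :: "'a pair_pre_digraph \<Rightarrow> ('a \<Rightarrow> nat) \<Rightarrow> bool" where
  "rdrd_function G f \<longleftrightarrow>
     (\<forall>v\<in>pverts G. f v \<in> {0, 1, 2, 3}) \<and>
     (\<forall>v\<in>pverts G. f v = 0 \<longrightarrow>
        (\<exists>u w. u \<noteq> w \<and> (v, u) \<in> parcs G \<and> (v, w) \<in> parcs G \<and> f u = 2 \<and> f w = 2) \<or>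
        (\<exists>u. (v, u) \<in> parcs G \<and> f u = 3)) \<and>
     (\<forall>v\<in>pverts G. f v = 1 \<longrightarrow> (\<exists>u. (v, u) \<in> parcs G \<and> f u \<ge> 2)) \<and>
     \<not> (\<exists>v. isolated_vertex (with_proj G \<restriction> {w \<in> pverts G. f w = 0}) v)"

definition weight :: "'a pair_pre_digraph \<Rightarrow> ('a \<Rightarrow> nat) \<Rightarrow> nat" where
  "weight G f = (\<Sum>v\<in>pverts G. f v)"

definition gamma_rdR :: "'a pair_pre_digraph \<Rightarrow> nat" where
  "gamma_rdR G = (LEAST w. \<exists>f. rdrd_function G f \<and> weight G f = w)"

lemma pair_graph_path_graph: "pair_graph (path_graph n)"
proof
  show "finite (parcs (path_graph n))"
    by (rule finite_subset[of _ "{1..n} \<times> {1..n}"]) (auto simp: path_graph_def)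
qed (auto simp: path_graph_def symmetric_def sym_def)

lemma pair_graph_direct_product:
  assumes "pair_graph G" "pair_graph H"
  shows "pair_graph (direct_product G H)"
proof -
  interpret G: pair_graph G by fact
  interpret H: pair_graph H by fact
  show ?thesis
  proof
    show "finite (parcs (direct_product G H))"
      by (rule finite_subset[of _ "(pverts G \<times> pverts H) \<times> (pverts G \<times> pverts H)"])
        (auto simp: direct_product_def dest: G.in_arcsD1 G.in_arcsD2 H.in_arcsD1 H.in_arcsD2)
    show "symmetric (with_proj (direct_product G H))"
      using G.graph_symmetric H.graph_symmetric
      by (auto simp: direct_product_def symmetric_def sym_def)
  qed (auto simp: direct_product_def G.pair_finite_verts H.pair_finite_verts
         dest: G.in_arcsD1 G.in_arcsD2 H.in_arcsD1 H.in_arcsD2 G.pair_no_loops)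
qed

text \<open>The constant function 2 is an RDRD-function, so the minimum weight is attained.\<close>

lemma gamma_rdR_attained: "\<exists>f. rdrd_function G f \<and> weight G f = gamma_rdR G"
proof -
  have "rdrd_function G (\<lambda>_. 2)"
    by (auto simp: rdrd_function_def isolated_vertex_def induce_subgraph_def)
  then have "\<exists>w f. rdrd_function G f \<and> weight G f = w" by blast
  then show ?thesis unfolding gamma_rdR_def by (rule LeastI_ex)
qed

lemma gamma_rdR_le: "rdrd_function G f \<Longrightarrow> gamma_rdR G \<le> weight G f"
  unfolding gamma_rdR_def by (rule Least_le) blast

end

theory Submission
  imports Defs
begin

text \<open>
  A walk in \<open>P\<^sub>2 \<times> H\<close> changes its first coordinate at every step. If \<open>H\<close> is bipartite, with
  colour classes 1 and 2, then the vertices \<open>(c v, v)\<close>, where \<open>c\<close> is the colouring, are therefore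
  never joined to the remaining vertices \<open>(3 - c v, v)\<close>, and each of the two parts is a copy of \<open>H\<close>.
  So \<open>\<gamma>\<^sub>r\<^sub>d\<^sub>R(P\<^sub>2 \<times> H) = 2 \<gamma>\<^sub>r\<^sub>d\<^sub>R(H)\<close> (\<open>gamma_rdR_edge_product_bipartite\<close>). Both inequalities come from
  one observation: the conditions on an RDRD-function concern only the values on the neighbourhood of
  a vertex, so such functions pull back along covering maps. The projection \<open>P\<^sub>2 \<times> H \<rightarrow> H\<close> and
  the two embeddings of \<open>H\<close> are covering maps.

  It remains to see that a path has \<open>\<gamma>\<^sub>r\<^sub>d\<^sub>R(P\<^sub>n) = n + 2\<close> for \<open>n \<ge> 4\<close> and \<open>n + 1\<close> for
  \<open>n \<le> 3\<close> (\<open>gamma_rdR_path\<close>). A vertex with value 0 needs a neighbour with value 0, so only one of its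
  neighbours can be positive and that one must have value 3. Hence zeros occur only in blocks
  \<open>3 0 0 3\<close>, and a 3 serves at most two zeros. The extreme 3s serve only one, so \<open>t\<close> threes allow at
  most \<open>2 t - 2\<close> zeros, and each three exceeds the average value 1 by 2 while each zero falls short
  of it by 1: the weight is at least \<open>n + 2\<close> (\<open>path_weight_with_zero\<close>). Without
  zeros the weight exceeds \<open>n\<close> by at least the number of values that are at least 2. Such a value is
  needed at or next to either end, and for \<open>n \<ge> 4\<close> one value cannot serve both ends
  (\<open>path_weight_without_zero\<close>). The pattern \<open>3 0 0 3 0 0 \<dots> 3\<close>, completed at the ends by values 1,
  attains the bound for \<open>n \<ge> 4\<close>, and \<open>2\<close>, \<open>2 1\<close>, \<open>1 2 1\<close> attain it for smaller \<open>n\<close>.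
\<close>

section \<open>RDRD-functions and covering maps\<close>

text \<open>
  The condition that the zeros induce a subgraph without isolated vertices turns into a condition on
  single neighbourhoods, like the other three.
\<close>

lemma rdrd_function_iff:
  assumes "pair_graph G"
  shows "rdrd_function G f \<longleftrightarrow>
    (\<forall>v\<in>pverts G.
      f v \<le> 3 \<and>
      (f v = 0 \<longrightarrow>
        (\<exists>u w. u \<noteq> w \<and> (v, u) \<in> parcs G \<and> (v, w) \<in> parcs G \<and> f u = 2 \<and> f w = 2) \<or>
        (\<exists>u. (v, u) \<in> parcs G \<and> f u = 3)) \<and>
      (f v = 1 \<longrightarrow> (\<exists>u. (v, u) \<in> parcs G \<and> f u \<ge> 2)) \<and>
      (f v = 0 \<longrightarrow> (\<exists>u. (v, u) \<in> parcs G \<and> f u = 0)))"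
proof -
  interpret pair_graph G by fact
  have range: "f v \<in> {0, 1, 2, 3} \<longleftrightarrow> f v \<le> 3" for v
    by auto
  have arc: "v \<rightarrow>\<^bsub>with_proj G \<restriction> S\<^esub> u \<longleftrightarrow> (v, u) \<in> parcs G \<and> v \<in> S \<and> u \<in> S" for S u v
    by (auto simp: arcs_ends_def arc_to_ends_def induce_subgraph_def)
  have isolated: "\<not> (\<exists>v. isolated_vertex (with_proj G \<restriction> {w \<in> pverts G. f w = 0}) v) \<longleftrightarrow>
      (\<forall>v\<in>pverts G. f v = 0 \<longrightarrow> (\<exists>u. (v, u) \<in> parcs G \<and> f u = 0))"
    unfolding isolated_vertex_def arc by auto (metis in_arcsD2 neq0_conv)
  show ?thesis
    unfolding rdrd_function_def isolated range ball_conj_distrib by (rule refl)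
qed

definition covering_map ::
    "'a pair_pre_digraph \<Rightarrow> 'b pair_pre_digraph \<Rightarrow> ('a \<Rightarrow> 'b) \<Rightarrow> bool" where
  "covering_map K H \<phi> \<longleftrightarrow> (\<forall>v\<in>pverts K. \<phi> v \<in> pverts H \<and>
     bij_betw \<phi> {u. (v, u) \<in> parcs K} {w. (\<phi> v, w) \<in> parcs H})"

text \<open>
  Neighbours of \<open>\<phi> v\<close> lift to neighbours of \<open>v\<close>, and distinct ones have distinct lifts, so every
  neighbour that the definition asks for at \<open>\<phi> v\<close> yields one at \<open>v\<close>.
\<close>

lemma rdrd_function_covering_map:
  assumes "pair_graph K" "pair_graph H" and cov: "covering_map K H \<phi>" and f: "rdrd_function H f"
  shows "rdrd_function K (f \<circ> \<phi>)"
proof -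
  have lift: "\<exists>u. (v, u) \<in> parcs K \<and> \<phi> u = w" if "v \<in> pverts K" "(\<phi> v, w) \<in> parcs H" for v w
  proof -
    have "\<phi> ` {u. (v, u) \<in> parcs K} = {w. (\<phi> v, w) \<in> parcs H}"
      using cov that(1) unfolding covering_map_def bij_betw_def by blast
    then have "w \<in> \<phi> ` {u. (v, u) \<in> parcs K}"
      using that(2) by simp
    then show ?thesis
      by auto
  qed
  have vert: "\<phi> v \<in> pverts H" if "v \<in> pverts K" for v
    using cov that unfolding covering_map_def by blast
  show ?thesis
    unfolding rdrd_function_iff[OF assms(1)]
  proof
    fix v assume v: "v \<in> pverts K"
    note fv = f[unfolded rdrd_function_iff[OF assms(2)], rule_format, OF vert[OF v]]
    have lift_one: "\<exists>u. (v, u) \<in> parcs K \<and> P ((f \<circ> \<phi>) u)"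
      if "\<exists>w. (\<phi> v, w) \<in> parcs H \<and> P (f w)" for P
      using that lift[OF v] by fastforce
    have lift_two: "\<exists>u w. u \<noteq> w \<and> (v, u) \<in> parcs K \<and> (v, w) \<in> parcs K \<and>
        (f \<circ> \<phi>) u = 2 \<and> (f \<circ> \<phi>) w = 2"
      if two: "\<exists>x y. x \<noteq> y \<and> (\<phi> v, x) \<in> parcs H \<and> (\<phi> v, y) \<in> parcs H \<and> f x = 2 \<and> f y = 2"
    proof -
      obtain x y where xy: "x \<noteq> y" "(\<phi> v, x) \<in> parcs H" "(\<phi> v, y) \<in> parcs H" "f x = 2" "f y = 2"
        using two by blast
      obtain u w where "(v, u) \<in> parcs K" "\<phi> u = x" "(v, w) \<in> parcs K" "\<phi> w = y"
        using lift[OF v xy(2)] lift[OF v xy(3)] by blast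
      then show ?thesis
        using xy by (intro exI[of _ u] exI[of _ w]) auto
    qed
    show "(f \<circ> \<phi>) v \<le> 3 \<and>
      ((f \<circ> \<phi>) v = 0 \<longrightarrow>
        (\<exists>u w. u \<noteq> w \<and> (v, u) \<in> parcs K \<and> (v, w) \<in> parcs K \<and> (f \<circ> \<phi>) u = 2 \<and> (f \<circ> \<phi>) w = 2) \<or>
        (\<exists>u. (v, u) \<in> parcs K \<and> (f \<circ> \<phi>) u = 3)) \<and>
      ((f \<circ> \<phi>) v = 1 \<longrightarrow> (\<exists>u. (v, u) \<in> parcs K \<and> (f \<circ> \<phi>) u \<ge> 2)) \<and>
      ((f \<circ> \<phi>) v = 0 \<longrightarrow> (\<exists>u. (v, u) \<in> parcs K \<and> (f \<circ> \<phi>) u = 0))"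
    proof (intro conjI impI)
      show "(f \<circ> \<phi>) v \<le> 3"
        using fv by simp
      show "\<exists>u. (v, u) \<in> parcs K \<and> (f \<circ> \<phi>) u \<ge> 2" if "(f \<circ> \<phi>) v = 1"
        using fv that by (intro lift_one) simp
      assume "(f \<circ> \<phi>) v = 0"
      then have f0: "f (\<phi> v) = 0"
        by simp
      show "\<exists>u. (v, u) \<in> parcs K \<and> (f \<circ> \<phi>) u = 0"
        using fv f0 by (intro lift_one) blast
      show "(\<exists>u w. u \<noteq> w \<and> (v, u) \<in> parcs K \<and> (v, w) \<in> parcs K \<and> (f \<circ> \<phi>) u = 2 \<and> (f \<circ> \<phi>) w = 2) \<or>
          (\<exists>u. (v, u) \<in> parcs K \<and> (f \<circ> \<phi>) u = 3)"
        using fv f0 lift_two lift_one[of "\<lambda>k. k = 3"] by blast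
    qed
  qed
qed

section \<open>The product of an edge with a bipartite graph\<close>

lemma parcs_path_graph_2: "parcs (path_graph 2) = {(1, 2), (2, 1)}"
  by (auto simp: path_graph_def)

lemma pverts_path_graph_2: "pverts (path_graph 2) = {1, 2}"
  by (auto simp: path_graph_def)

lemma covering_map_snd: "covering_map (direct_product (path_graph 2) H) H snd"
  unfolding covering_map_def
proof
  fix v assume "v \<in> pverts (direct_product (path_graph 2) H)"
  then obtain i w where v: "v = (i, w)" "i = 1 \<or> i = 2" "w \<in> pverts H"
    by (auto simp: direct_product_def pverts_path_graph_2)
  then show "snd v \<in> pverts H \<and>
      bij_betw snd {u. (v, u) \<in> parcs (direct_product (path_graph 2) H)} {w. (snd v, w) \<in> parcs H}"
    by (auto simp: direct_product_def parcs_path_graph_2 bij_betw_def inj_on_def image_iff)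
qed

text \<open>
  Along an arc of \<open>H\<close> the colour changes between 1 and 2, exactly as the first coordinate does along an
  arc of the product. Thus \<open>(c v, v)\<close> has no neighbours outside the image of the embedding.
\<close>

lemma covering_map_layer:
  assumes "\<And>v. v \<in> pverts H \<Longrightarrow> c v = 1 \<or> c v = 2"
    and "\<And>v w. (v, w) \<in> parcs H \<Longrightarrow> c v \<noteq> c w"
    and "pair_graph H"
  shows "covering_map H (direct_product (path_graph 2) H) (\<lambda>v. (c v, v))"
  unfolding covering_map_def
proof
  interpret pair_graph H by fact
  fix v assume v: "v \<in> pverts H"
  have other: "c w = 3 - c v" if "(v, w) \<in> parcs H" for w
    using assms(1)[OF v] assms(1)[OF in_arcsD2[OF that]] assms(2)[OF that] by auto
  show "(c v, v) \<in> pverts (direct_product (path_graph 2) H) \<and>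
      bij_betw (\<lambda>v. (c v, v)) {u. (v, u) \<in> parcs H}
        {w. ((c v, v), w) \<in> parcs (direct_product (path_graph 2) H)}"
    using v assms(1)[OF v] other
    by (auto simp: direct_product_def parcs_path_graph_2 pverts_path_graph_2
        bij_betw_def inj_on_def image_iff)
qed

text \<open>
  An optimal function on \<open>H\<close>, pulled back along the projection, has twice its weight. Conversely, the
  embeddings for the colouring and for its swap have disjoint images that cover the product, so the
  weights of the two pullbacks of a function on the product add up to its weight.
\<close>

lemma gamma_rdR_edge_product_bipartite:
  fixes c :: "'a \<Rightarrow> nat"
  assumes H: "pair_graph H"
    and c: "\<And>v. v \<in> pverts H \<Longrightarrow> c v = 1 \<or> c v = 2"
    and proper: "\<And>v w. (v, w) \<in> parcs H \<Longrightarrow> c v \<noteq> c w"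
  shows "gamma_rdR (direct_product (path_graph 2) H) = 2 * gamma_rdR H"
proof -
  let ?K = "direct_product (path_graph 2) H"
  interpret pair_graph H by fact
  have K: "pair_graph ?K"
    by (intro pair_graph_direct_product pair_graph_path_graph H)
  have weight_K: "weight ?K f = (\<Sum>v\<in>pverts H. f (1, v) + f (2, v))" for f
  proof -
    have "weight ?K f = (\<Sum>i\<in>{1, 2}. \<Sum>v\<in>pverts H. f (i, v))"
      by (simp only: weight_def direct_product_def pverts_path_graph_2 pair_pre_digraph.simps
          sum.cartesian_product case_prod_eta)
    then show ?thesis
      by (simp add: sum.distrib)
  qed
  show ?thesis
  proof (rule antisym)
    obtain g where g: "rdrd_function H g" "weight H g = gamma_rdR H"
      using gamma_rdR_attained by blast
    have "gamma_rdR ?K \<le> weight ?K (g \<circ> snd)"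
      by (intro gamma_rdR_le rdrd_function_covering_map[OF K H] covering_map_snd g(1))
    also have "\<dots> = 2 * gamma_rdR H"
      unfolding weight_K g(2)[symmetric] by (simp add: weight_def sum_distrib_left mult_2)
    finally show "gamma_rdR ?K \<le> 2 * gamma_rdR H" .
  next
    obtain f where f: "rdrd_function ?K f" "weight ?K f = gamma_rdR ?K"
      using gamma_rdR_attained by blast
    let ?d = "\<lambda>v. 3 - c v"
    have d: "?d v = 1 \<or> ?d v = 2" if "v \<in> pverts H" for v
      using c[OF that] by auto
    have d_proper: "?d v \<noteq> ?d w" if "(v, w) \<in> parcs H" for v w
      using c[OF in_arcsD1[OF that]] c[OF in_arcsD2[OF that]] proper[OF that] by auto
    have "gamma_rdR H \<le> weight H (f \<circ> (\<lambda>v. (c v, v)))"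
      by (intro gamma_rdR_le rdrd_function_covering_map[OF H K] covering_map_layer H c proper f(1))
    moreover have "gamma_rdR H \<le> weight H (f \<circ> (\<lambda>v. (?d v, v)))"
      by (intro gamma_rdR_le rdrd_function_covering_map[OF H K] covering_map_layer H d d_proper f(1))
    moreover have "weight H (f \<circ> (\<lambda>v. (c v, v))) + weight H (f \<circ> (\<lambda>v. (?d v, v))) = weight ?K f"
      unfolding weight_K unfolding weight_def sum.distrib[symmetric]
      by (rule sum.cong) (auto dest: c)
    ultimately show "2 * gamma_rdR H \<le> gamma_rdR ?K"
      using f(2) by simp
  qed
qed

section \<open>Paths\<close>

lemma sum_add_indicator:
  fixes h :: "'a \<Rightarrow> nat"
  assumes "finite A" "S \<subseteq> A"
  shows "(\<Sum>i\<in>A. h i + (if i \<in> S then k else 0)) = sum h A + k * card S"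
proof -
  have "(\<Sum>i\<in>A. if i \<in> S then k else 0) = (\<Sum>i\<in>S. k)"
    using assms by (subst sum.inter_restrict[symmetric]) (auto simp: Int_absorb1)
  then show ?thesis
    by (simp add: sum.distrib)
qed

lemma path_arc_iff:
  "(i, j) \<in> parcs (path_graph n) \<longleftrightarrow> i \<in> {1..n} \<and> j \<in> {1..n} \<and> (j = i + 1 \<or> i = j + 1)"
  by (simp add: path_graph_def)

lemma pverts_path_graph: "pverts (path_graph n) = {1..n}"
  by (simp add: path_graph_def)

lemmas rdrd_path_iff =
  rdrd_function_iff[OF pair_graph_path_graph, unfolded pverts_path_graph path_arc_iff]

text \<open>
  One neighbour of a zero must itself be a zero, so two neighbours with value 2 are impossible: a zero
  is an inner vertex between a 0 and a 3.
\<close>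

lemma rdrd_path_zero:
  assumes g: "rdrd_function (path_graph n) g" and i: "i \<in> {1..n}" "g i = 0"
  shows "1 < i \<and> i < n \<and> (g (i - 1) = 3 \<and> g (i + 1) = 0 \<or> g (i - 1) = 0 \<and> g (i + 1) = 3)"
proof -
  obtain u where u: "u \<in> {1..n}" "u = i + 1 \<or> i = u + 1" "g u = 0"
    using g i unfolding rdrd_path_iff by blast
  have "\<exists>w. w \<in> {1..n} \<and> (w = i + 1 \<or> i = w + 1) \<and> g w = 3"
  proof (rule ccontr)
    assume "\<not> ?thesis"
    then obtain w w' where "w \<noteq> w'" "w = i + 1 \<or> i = w + 1" "w' = i + 1 \<or> i = w' + 1"
        "g w = 2" "g w' = 2"
      using g i unfolding rdrd_path_iff by blast
    then show False
      using u by auto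
  qed
  then obtain w where w: "w \<in> {1..n}" "w = i + 1 \<or> i = w + 1" "g w = 3"
    by blast
  from u w show ?thesis
    by auto
qed

text \<open>
  Charge each zero to its neighbour with value 3. Let \<open>L\<close> and \<open>R\<close> be the zeros whose 3 is on their left
  and on their right. Both charging maps are injective, and neither is onto the threes: the 3 to
  the right of the last zero is never charged from its right, nor the 3 to the left of the first zero
  from its left.
\<close>

lemma path_weight_with_zero:
  assumes g: "rdrd_function (path_graph n) g" and zero: "\<exists>i\<in>{1..n}. g i = 0"
  shows "n + 2 \<le> weight (path_graph n) g"
proof -
  define Z where "Z = {i \<in> {1..n}. g i = 0}"
  define T where "T = {i \<in> {1..n}. g i = 3}"
  define L where "L = {i \<in> Z. g (i - 1) = 3}"
  define R where "R = {i \<in> Z. g (i + 1) = 3}"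
  have fin: "finite Z" "finite T" "finite L" "finite R"
    by (simp_all add: Z_def T_def L_def R_def)
  have ne: "Z \<noteq> {}"
    using zero by (auto simp: Z_def)
  have nb: "1 < i \<and> i < n \<and> (g (i - 1) = 3 \<and> g (i + 1) = 0 \<or> g (i - 1) = 0 \<and> g (i + 1) = 3)"
    if "i \<in> Z" for i
    using rdrd_path_zero[OF g] that by (auto simp: Z_def)
  have min_in: "Min Z \<in> Z" and max_in: "Max Z \<in> Z"
    using fin ne by auto
  have "Min Z - 1 \<notin> Z"
    using nb[OF min_in] Min_le[OF fin(1), of "Min Z - 1"] by auto
  then have min3: "Min Z - 1 \<in> T"
    using nb[OF min_in] by (auto simp: Z_def T_def)
  have "Max Z + 1 \<notin> Z"
    using Max_ge[OF fin(1), of "Max Z + 1"] by auto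
  then have max3: "Max Z + 1 \<in> T"
    using nb[OF max_in] by (auto simp: Z_def T_def)
  have "(\<lambda>i. i - 1) ` L \<subseteq> T - {Max Z + 1}"
    using nb Max_ge[OF fin(1)] by (fastforce simp: L_def T_def)
  moreover have "inj_on (\<lambda>i. i - 1) L"
    using nb by (intro inj_onI) (fastforce simp: L_def)
  ultimately have "card L \<le> card (T - {Max Z + 1})"
    using fin by (intro card_inj_on_le) auto
  then have L: "card L + 1 \<le> card T"
    using max3 fin(2) card_Suc_Diff1[of T "Max Z + 1"] by linarith
  have "(\<lambda>i. i + 1) ` R \<subseteq> T - {Min Z - 1}"
    using nb Min_le[OF fin(1)] by (fastforce simp: R_def T_def)
  then have "card R \<le> card (T - {Min Z - 1})"
    using fin by (intro card_inj_on_le[where f = "\<lambda>i. i + 1"]) auto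
  then have R: "card R + 1 \<le> card T"
    using min3 fin(2) card_Suc_Diff1[of T "Min Z - 1"] by linarith
  have "Z = L \<union> R"
    using nb by (auto simp: L_def R_def)
  then have Z: "card Z \<le> card L + card R"
    by (simp add: card_Un_le)
  have "n + 2 * card T = (\<Sum>i\<in>{1..n}. 1 + (if i \<in> T then 2 else 0))"
    by (subst sum_add_indicator) (auto simp: T_def)
  also have "\<dots> \<le> (\<Sum>i\<in>{1..n}. g i + (if i \<in> Z then 1 else 0))"
    by (rule sum_mono) (auto simp: T_def Z_def)
  also have "\<dots> = weight (path_graph n) g + card Z"
    unfolding weight_def pverts_path_graph by (subst sum_add_indicator) (auto simp: Z_def)
  finally show ?thesis
    using L R Z by linarith
qed

text \<open>
  The closed neighbourhoods of the two ends each contain a value that is at least 2; for \<open>n \<ge> 4\<close>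
  they are disjoint.
\<close>

lemma path_weight_without_zero:
  assumes g: "rdrd_function (path_graph n) g" and pos: "\<forall>i\<in>{1..n}. g i \<noteq> 0" and n: "n \<ge> 1"
  shows "n + (if n \<ge> 4 then 2 else 1) \<le> weight (path_graph n) g"
proof -
  have big: "\<exists>j\<in>{1..n}. (j = i \<or> j = i + 1 \<or> i = j + 1) \<and> g j \<ge> 2" if "i \<in> {1..n}" for i
  proof (cases "g i = 1")
    case True
    then show ?thesis
      using g that unfolding rdrd_path_iff by blast
  next
    case False
    moreover have "g i \<noteq> 0"
      using pos that by blast
    ultimately have "g i \<ge> 2"
      by linarith
    then show ?thesis
      using that by blast
  qed
  have ends: "1 \<in> {1..n}" "n \<in> {1..n}"
    using n by auto
  obtain a where a: "a \<in> {1..n}" "a = 1 \<or> a = 1 + 1 \<or> 1 = a + 1" "g a \<ge> 2"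
    using big[OF ends(1)] by blast
  obtain b where b: "b \<in> {1..n}" "b = n \<or> b = n + 1 \<or> n = b + 1" "g b \<ge> 2"
    using big[OF ends(2)] by blast
  have "n + card {a, b} = (\<Sum>i\<in>{1..n}. 1 + (if i \<in> {a, b} then 1 else 0))"
    using a b by (subst sum_add_indicator) auto
  also have "\<dots> \<le> weight (path_graph n) g"
    unfolding weight_def pverts_path_graph
  proof (rule sum_mono)
    fix i assume "i \<in> {1..n}"
    then show "1 + (if i \<in> {a, b} then 1 else 0) \<le> g i"
      using a b pos by (auto simp: Suc_le_eq)
  qed
  finally have "n + card {a, b} \<le> weight (path_graph n) g" .
  moreover have "(if n \<ge> 4 then 2 else 1) \<le> card {a, b}"
    using a b by (auto simp: card_insert_if)
  ultimately show ?thesis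
    by linarith
qed

lemma sum_mod_3:
  assumes "r = 1 \<or> r = 2"
  shows "(\<Sum>j = 1..n. if j mod 3 = r then 3 else 0 :: nat) = 3 * ((n + 3 - r) div 3)"
  using assms
proof
  assume r: "r = 1"
  show ?thesis
    unfolding r by (induction n) (auto simp: div_Suc mod_Suc)
next
  assume r: "r = 2"
  show ?thesis
    unfolding r by (induction n) (auto simp: div_Suc mod_Suc)
qed

text \<open>
  Every third vertex gets 3, starting at vertex 1 if \<open>n mod 3 = 1\<close>, so that both ends get 3, and at
  vertex 2 otherwise. An end that is missed is next to a 3 and gets 1; it would be a zero without a zero
  neighbour if it got 0.
\<close>

lemma path_rdrd_long:
  assumes n: "n \<ge> 4"
  shows "\<exists>g. rdrd_function (path_graph n) g \<and> weight (path_graph n) g = n + 2"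
proof -
  define r :: nat where "r = (if n mod 3 = 1 then 1 else 2)"
  define g :: "nat \<Rightarrow> nat" where
    "g j = (if j mod 3 = r then 3 else if j = 1 \<or> j = n then 1 else 0)" for j
  have r: "n mod 3 = 1 \<and> r = 1 \<or> n mod 3 \<noteq> 1 \<and> r = 2"
    by (simp add: r_def)
  have three: "\<exists>j. j \<in> {1..n} \<and> (j = i + 1 \<or> i = j + 1) \<and> g j = 3"
    if "i \<in> {1..n}" "g i \<noteq> 3" for i
  proof -
    have "(i + 1 \<le> n \<and> (i + 1) mod 3 = r) \<or> (2 \<le> i \<and> (i - 1) mod 3 = r)"
    proof -
      have i: "1 \<le> i" "i \<le> n" "i mod 3 \<noteq> r"
        using that by (auto simp: g_def)
      obtain k where k: "i = Suc k"
        using i(1) by (cases i) auto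
      have "i \<noteq> n \<or> n mod 3 \<noteq> 1"
        using r i by auto
      then show ?thesis
        using i r unfolding k by (auto simp: mod_Suc Suc_le_eq le_less split: if_splits)
    qed
    then show ?thesis
    proof
      assume "i + 1 \<le> n \<and> (i + 1) mod 3 = r"
      then show ?thesis by (intro exI[of _ "i + 1"]) (auto simp: g_def)
    next
      assume "2 \<le> i \<and> (i - 1) mod 3 = r"
      then show ?thesis using that by (intro exI[of _ "i - 1"]) (auto simp: g_def)
    qed
  qed
  have zero: "\<exists>j. j \<in> {1..n} \<and> (j = i + 1 \<or> i = j + 1) \<and> g j = 0"
    if i: "i \<in> {1..n}" "g i = 0" for i
  proof -
    have "(i + 1 < n \<and> (i + 1) mod 3 \<noteq> r) \<or> (2 < i \<and> (i - 1) mod 3 \<noteq> r)"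
    proof -
      have i': "1 < i" "i < n" "i mod 3 \<noteq> r"
        using i by (auto simp: g_def split: if_splits)
      obtain k where k: "i = Suc k"
        using i'(1) by (cases i) auto
      have "i + 1 < n \<or> i + 1 = n"
        using i' by auto
      then show ?thesis
        using i' r unfolding k by (auto simp: mod_Suc Suc_le_eq le_less split: if_splits)
    qed
    then show ?thesis
    proof
      assume "i + 1 < n \<and> (i + 1) mod 3 \<noteq> r"
      then show ?thesis using i by (intro exI[of _ "i + 1"]) (auto simp: g_def)
    next
      assume "2 < i \<and> (i - 1) mod 3 \<noteq> r"
      then show ?thesis using i by (intro exI[of _ "i - 1"]) (auto simp: g_def)
    qed
  qed
  have "rdrd_function (path_graph n) g"
    unfolding rdrd_path_iff
  proof (intro ballI conjI impI)
    fix i assume i: "i \<in> {1..n}"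
    show "g i \<le> 3" by (simp add: g_def)
    show "\<exists>u. (i \<in> {1..n} \<and> u \<in> {1..n} \<and> (u = i + 1 \<or> i = u + 1)) \<and> 2 \<le> g u" if "g i = 1"
    proof -
      have "g i \<noteq> 3" using that by simp
      from three[OF i this] obtain j where "j \<in> {1..n}" "j = i + 1 \<or> i = j + 1" "g j = 3" by blast
      then show ?thesis using i by (intro exI[of _ j]) auto
    qed
    assume i0: "g i = 0"
    then show "\<exists>u. (i \<in> {1..n} \<and> u \<in> {1..n} \<and> (u = i + 1 \<or> i = u + 1)) \<and> g u = 0"
      using zero[OF i] i by blast
    from i0 have "g i \<noteq> 3" by simp
    from three[OF i this]
    show "(\<exists>u w. u \<noteq> w \<and> (i \<in> {1..n} \<and> u \<in> {1..n} \<and> (u = i + 1 \<or> i = u + 1)) \<and>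
        (i \<in> {1..n} \<and> w \<in> {1..n} \<and> (w = i + 1 \<or> i = w + 1)) \<and> g u = 2 \<and> g w = 2) \<or>
        (\<exists>u. (i \<in> {1..n} \<and> u \<in> {1..n} \<and> (u = i + 1 \<or> i = u + 1)) \<and> g u = 3)"
      using i by blast
  qed
  moreover have "weight (path_graph n) g = n + 2"
  proof -
    define E where "E = {j \<in> {1, n}. j mod 3 \<noteq> r}"
    have "weight (path_graph n) g =
        (\<Sum>j = 1..n. (if j mod 3 = r then 3 else 0) + (if j \<in> E then 1 else 0))"
      unfolding weight_def pverts_path_graph by (rule sum.cong) (auto simp: g_def E_def)
    also have "\<dots> = (\<Sum>j = 1..n. if j mod 3 = r then 3 else 0) + 1 * card E"
      using n by (intro sum_add_indicator) (auto simp: E_def)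
    also have "\<dots> = 3 * ((n + 3 - r) div 3) + card E"
      by (subst sum_mod_3) (auto simp: r_def)
    also have "\<dots> = n + 2"
    proof -
      consider "n mod 3 = 0" | "n mod 3 = 1" | "n mod 3 = 2"
        by linarith
      then show ?thesis
      proof cases
        case 1
        then have "r = 2" "E = {1, n}"
          by (auto simp: r_def E_def)
        then show ?thesis
          using 1 n by (auto simp: card_insert_if)
      next
        case 2
        then have "r = 1" "E = {}"
          by (auto simp: r_def E_def)
        moreover have "(n + 2) mod 3 = 0"
          using 2 by (simp add: mod_Suc)
        ultimately show ?thesis
          by auto
      next
        case 3
        then have "r = 2" "E = {1}"
          by (auto simp: r_def E_def)
        moreover have "(n + 1) mod 3 = 0"
          using 3 by (simp add: mod_Suc)
        ultimately show ?thesis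
          by auto
      qed
    qed
    finally show ?thesis .
  qed
  ultimately show ?thesis by blast
qed

lemma path_rdrd_short:
  assumes n: "1 \<le> n" "n \<le> 3"
  shows "\<exists>g. rdrd_function (path_graph n) g \<and> weight (path_graph n) g = n + 1"
proof -
  define m where "m = (n + 1) div 2"
  define g :: "nat \<Rightarrow> nat" where "g j = (if j = m then 2 else 1)" for j
  have m: "m \<in> {1..n}" "\<And>j. j \<in> {1..n} \<Longrightarrow> j \<noteq> m \<Longrightarrow> m = j + 1 \<or> j = m + 1"
    using n by (auto simp: m_def)
  have "rdrd_function (path_graph n) g"
    unfolding rdrd_path_iff using m by (auto simp: g_def)
  moreover have "weight (path_graph n) g = n + 1"
  proof -
    have "weight (path_graph n) g = (\<Sum>j = 1..n. 1 + (if j \<in> {m} then 1 else 0))"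
      unfolding weight_def pverts_path_graph by (rule sum.cong) (auto simp: g_def)
    also have "\<dots> = n + 1"
      using m(1) by (subst sum_add_indicator) auto
    finally show ?thesis .
  qed
  ultimately show ?thesis by blast
qed

lemma gamma_rdR_path:
  assumes "n \<ge> 1"
  shows "gamma_rdR (path_graph n) = n + (if n \<ge> 4 then 2 else 1)"
proof (rule antisym)
  have "\<exists>g. rdrd_function (path_graph n) g \<and>
      weight (path_graph n) g = n + (if n \<ge> 4 then 2 else 1)"
    using path_rdrd_long[of n] path_rdrd_short[of n] assms by auto
  then show "gamma_rdR (path_graph n) \<le> n + (if n \<ge> 4 then 2 else 1)"
    using gamma_rdR_le by metis
next
  obtain g where g: "rdrd_function (path_graph n) g" "weight (path_graph n) g = gamma_rdR (path_graph n)"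
    using gamma_rdR_attained by blast
  show "n + (if n \<ge> 4 then 2 else 1) \<le> gamma_rdR (path_graph n)"
    using path_weight_with_zero[OF g(1)] path_weight_without_zero[OF g(1) _ assms] g(2)
    by (cases "\<exists>i\<in>{1..n}. g i = 0") auto
qed

theorem corollary4p4:
  fixes n :: nat
  assumes "n \<ge> 1"
  shows "gamma_rdR (direct_product (path_graph 2) (path_graph n)) =
    (if n \<ge> 4 then 2 * n + 4 else 2 * n + 2)"
proof -
  have "gamma_rdR (direct_product (path_graph 2) (path_graph n)) = 2 * gamma_rdR (path_graph n)"
  proof (rule gamma_rdR_edge_product_bipartite[where c = "\<lambda>i. 1 + i mod 2"])
    show "1 + v mod 2 \<noteq> 1 + w mod 2" if "(v, w) \<in> parcs (path_graph n)" for v w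
      using that unfolding path_arc_iff by (auto simp: mod_Suc split: if_splits)
  qed (auto simp: pair_graph_path_graph)
  then show ?thesis
    using gamma_rdR_path[OF assms] by simp
qed

end
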